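(* Let $\rho\in(0,2]$, $\nu\in[0,1]$, $\alpha=\sqrt{8\rho^{-1}-4}$, $\beta=2\rho^{-1}-2$, and let $X\in\mathbb{B}(\mathcal{H})$. Then $$\frac14\left\|\begin{bmatrix}\mathbf{M}&\mathbf{N}\\ \mathbf{N}^*&\mathbf{P}\end{bmatrix}\right\|+\frac12\,c\left(\begin{bmatrix}\mathbf{Q}&\mathbf{R}\\ \mathbf{T}&\mathbf{S}\end{bmatrix}\right)\leq\Delta_{(\rho,\nu)}(X)^2\leq\frac14\left\|\begin{bmatrix}\mathbf{M}&\mathbf{N}\\ \mathbf{N}^*&\mathbf{P}\end{bmatrix}\right\|+\frac12\,w\left(\begin{bmatrix}\mathbf{Q}&\mathbf{R}\\ \mathbf{T}&\mathbf{S}\end{bmatrix}\right),$$ where $$\mathbf{Q}=\alpha^2(1-2\nu)|X^*|^2,\qquad \mathbf{R}=\alpha\beta\left(X^2+(1-2\nu)|X^*|^2\right),$$ $$\mathbf{T}=\alpha\beta(1-2\nu)\left(|X^*|^2+(1-2\nu)(X^* )^2\right),\qquad \mathbf{S}=\alpha^2(1-2\nu)|X|^2+\beta^2\left(X+(1-2\nu)X^*\right)^2,$$ $$\mathbf{M}=\alpha^2\left(1+(1-2\nu)^2\right)|X^*|^2,\qquad \mathbf{N}=2\alpha\beta(1-2\nu)X^2+\alpha\beta\left(1+(1-2\nu)^2\right)|X^*|^2,$$ and $$\mathbf{P}=\alpha^2\left(1+(1-2\nu)^2\right)|X|^2+\beta^2\left(\left|X+(1-2\nu)X^*\right|^2+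\left|X^*+(1-2\nu)X\right|^2\right).$$
   Context: $\mathbb{B}(\mathcal{H})$ is the $C^*$-algebra of bounded linear operators on a complex Hilbert space $\mathcal{H}$, $\|\cdot\|$ is the operator norm, and $|A|=(A^*A)^{1/2}$. For a bounded operator $A$ on a complex Hilbert space, $w(A)=\sup_{\|z\|=1}|\langle Az,z\rangle|$ is the numerical radius and $c(A)=\inf_{\|z\|=1}|\langle Az,z\rangle|$ is the Crawford number. For $\rho\in(0,2]$, $\nu\in[0,1]$, $\alpha=\sqrt{8\rho^{-1}-4}$, $\beta=2\rho^{-1}-2$ and $X\in\mathbb{B}(\mathcal{H})$ define $$\Delta_{(\rho,\nu)}(X)=w\left(\begin{bmatrix}0&\alpha X\\ \alpha(1-2\nu)X^*&\beta\left(X+(1-2\nu)X^*\right)\end{bmatrix}\right).$$ All $2\times2$ operator matrices act on $\mathcal{H}\oplus\mathcal{H}$. *)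

theory Defs
  imports "HOL-Analysis.Analysis"
begin

text \<open>
  Complex Hilbert spaces. The inner product is linear in its first argument. The axiom
  \<open>cinner_self\<close> says at once that the inner product is positive definite and that the norm
  is the one it induces.
\<close>

class complex_inner = real_normed_vector +
  fixes scaleC :: "complex \<Rightarrow> 'a \<Rightarrow> 'a"  (infixr "*\<^sub>C" 75)
    and cinner :: "'a \<Rightarrow> 'a \<Rightarrow> complex"
  assumes scaleC_add_right: "c *\<^sub>C (x + y) = c *\<^sub>C x + c *\<^sub>C y"
    and scaleC_add_left: "(c + d) *\<^sub>C x = c *\<^sub>C x + d *\<^sub>C x"
    and scaleC_scaleC: "c *\<^sub>C (d *\<^sub>C x) = (c * d) *\<^sub>C x"
    and scaleC_of_real: "complex_of_real r *\<^sub>C x = r *\<^sub>R x"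
    and cinner_add_left: "cinner (x + y) z = cinner x z + cinner y z"
    and cinner_scaleC_left: "cinner (c *\<^sub>C x) y = c * cinner x y"
    and cinner_commute: "cinner x y = cnj (cinner y x)"
    and cinner_self: "cinner x x = complex_of_real ((norm x)\<^sup>2)"

class chilbert_space = complex_inner + complete_space

subclass (in chilbert_space) banach ..

instantiation complex :: chilbert_space
begin

definition scaleC_complex :: "complex \<Rightarrow> complex \<Rightarrow> complex" where
  "scaleC_complex c x = c * x"

definition cinner_complex :: "complex \<Rightarrow> complex \<Rightarrow> complex" where
  "cinner_complex x y = x * cnj y"

instance
  by standard
    (auto simp: scaleC_complex_def cinner_complex_def algebra_simps scaleR_conv_of_real
      simp flip: complex_norm_square of_real_power)

end

text \<open>
  The Hilbert space direct sum is the product type, whose library norm is already the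
  Hilbertian one.
\<close>

instantiation prod :: (complex_inner, complex_inner) complex_inner
begin

definition scaleC_prod :: "complex \<Rightarrow> 'a \<times> 'b \<Rightarrow> 'a \<times> 'b" where
  "scaleC_prod c z = (c *\<^sub>C fst z, c *\<^sub>C snd z)"

definition cinner_prod :: "'a \<times> 'b \<Rightarrow> 'a \<times> 'b \<Rightarrow> complex" where
  "cinner_prod z w = cinner (fst z) (fst w) + cinner (snd z) (snd w)"

instance
proof
  fix c d :: complex and r :: real and x y z :: "'a \<times> 'b"
  show "c *\<^sub>C (x + y) = c *\<^sub>C x + c *\<^sub>C y"
    by (simp add: scaleC_prod_def scaleC_add_right)
  show "(c + d) *\<^sub>C x = c *\<^sub>C x + d *\<^sub>C x"
    by (simp add: scaleC_prod_def scaleC_add_left)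
  show "c *\<^sub>C (d *\<^sub>C x) = (c * d) *\<^sub>C x"
    by (simp add: scaleC_prod_def scaleC_scaleC)
  show "complex_of_real r *\<^sub>C x = r *\<^sub>R x"
    by (simp add: scaleC_prod_def scaleC_of_real scaleR_prod_def)
  show "cinner (x + y) z = cinner x z + cinner y z"
    by (simp add: cinner_prod_def cinner_add_left)
  show "cinner (c *\<^sub>C x) y = c * cinner x y"
    by (simp add: cinner_prod_def scaleC_prod_def cinner_scaleC_left algebra_simps)
  show "cinner x y = cnj (cinner y x)"
    by (simp add: cinner_prod_def flip: cinner_commute)
  show "cinner x x = complex_of_real ((norm x)\<^sup>2)"
    by (simp add: cinner_prod_def cinner_self norm_prod_def)
qed

end

instance prod :: (chilbert_space, chilbert_space) chilbert_space ..

text \<open>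
  The library type of bounded operators on \<open>'a\<close> consists of the bounded \<^emph>\<open>real\<close>-linear maps;
  the algebra of bounded operators on the complex space \<open>'a\<close> is the subset of complex-linear
  ones. Its norm is the operator norm.
\<close>

definition bounded_operators :: "('a::complex_inner \<Rightarrow>\<^sub>L 'a) set" where
  "bounded_operators = {A. \<forall>c x. blinfun_apply A (c *\<^sub>C x) = c *\<^sub>C blinfun_apply A x}"

abbreviation op_sq :: "('a::real_normed_vector \<Rightarrow>\<^sub>L 'a) \<Rightarrow> ('a \<Rightarrow>\<^sub>L 'a)" where
  "op_sq A \<equiv> A o\<^sub>L A"

definition adj :: "('a::chilbert_space \<Rightarrow>\<^sub>L 'a) \<Rightarrow> ('a \<Rightarrow>\<^sub>L 'a)" where
  "adj A = (THE B. \<forall>x y. cinner (blinfun_apply A x) y = cinner x (blinfun_apply B y))"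

definition positive_operator :: "('a::complex_inner \<Rightarrow>\<^sub>L 'a) \<Rightarrow> bool" where
  "positive_operator A \<longleftrightarrow>
     A \<in> bounded_operators \<and> (\<forall>x. cinner (blinfun_apply A x) x \<in> \<real>\<^sub>\<ge>\<^sub>0)"

definition op_sqrt :: "('a::chilbert_space \<Rightarrow>\<^sub>L 'a) \<Rightarrow> ('a \<Rightarrow>\<^sub>L 'a)" where
  "op_sqrt A = (THE B. positive_operator B \<and> op_sq B = A)"

definition op_abs :: "('a::chilbert_space \<Rightarrow>\<^sub>L 'a) \<Rightarrow> ('a \<Rightarrow>\<^sub>L 'a)" where
  "op_abs A = op_sqrt (adj A o\<^sub>L A)"

text \<open>
  As real suprema and infima these are meaningful only on a nonzero space, where unit vectors
  exist.
\<close>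

definition numerical_radius :: "('a::complex_inner \<Rightarrow>\<^sub>L 'a) \<Rightarrow> real" where
  "numerical_radius A = (SUP z\<in>{z. norm z = 1}. cmod (cinner (blinfun_apply A z) z))"

definition crawford_number :: "('a::complex_inner \<Rightarrow>\<^sub>L 'a) \<Rightarrow> real" where
  "crawford_number A = (INF z\<in>{z. norm z = 1}. cmod (cinner (blinfun_apply A z) z))"

text \<open>\<open>op_matrix A B C D\<close> is the operator matrix with rows \<open>A B\<close> and \<open>C D\<close>.\<close>

definition op_matrix ::
  "('a::real_normed_vector \<Rightarrow>\<^sub>L 'a) \<Rightarrow> ('a \<Rightarrow>\<^sub>L 'a) \<Rightarrow> ('a \<Rightarrow>\<^sub>L 'a) \<Rightarrow> ('a \<Rightarrow>\<^sub>L 'a) \<Rightarrow>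
   ('a \<times> 'a) \<Rightarrow>\<^sub>L ('a \<times> 'a)" where
  "op_matrix A B C D =
     Blinfun (\<lambda>z. (blinfun_apply A (fst z) + blinfun_apply B (snd z),
                   blinfun_apply C (fst z) + blinfun_apply D (snd z)))"

lemma blinfun_apply_op_matrix:
  "blinfun_apply (op_matrix A B C D) z =
     (blinfun_apply A (fst z) + blinfun_apply B (snd z),
      blinfun_apply C (fst z) + blinfun_apply D (snd z))"
  unfolding op_matrix_def
  by (subst bounded_linear_Blinfun_apply)
    (auto intro!: bounded_linear_Pair bounded_linear_add blinfun.bounded_linear_right
      bounded_linear_compose[OF blinfun.bounded_linear_right] bounded_linear_fst bounded_linear_snd)

definition Delta :: "real \<Rightarrow> real \<Rightarrow> ('a::chilbert_space \<Rightarrow>\<^sub>L 'a) \<Rightarrow> real" where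
  "Delta \<rho> \<nu> X =
     (let \<alpha> = sqrt (8 / \<rho> - 4); \<beta> = 2 / \<rho> - 2
      in numerical_radius
           (op_matrix 0 (\<alpha> *\<^sub>R X)
              ((\<alpha> * (1 - 2 * \<nu>)) *\<^sub>R adj X) (\<beta> *\<^sub>R (X + (1 - 2 * \<nu>) *\<^sub>R adj X))))"

end

theory Submission
  imports Defs
begin

text \<open>
  For unimodular \<open>c\<close> the real part \<open>H\<close> of \<open>cA\<close> satisfies
  \<open>\<parallel>Hx\<parallel>\<^sup>2 = \<langle>(A\<^sup>*A + AA\<^sup>*)x,x\<rangle>/4 + Re (c\<^sup>2\<langle>A\<^sup>2x,x\<rangle>)/2\<close>.
  Choosing \<open>c\<close> so that \<open>c\<langle>Ax,x\<rangle> = \<bar>\<langle>Ax,x\<rangle>\<bar>\<close> bounds \<open>w(A)\<^sup>2\<close> from above; choosing it so that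
  \<open>c\<^sup>2\<langle>A\<^sup>2x,x\<rangle> = \<bar>\<langle>A\<^sup>2x,x\<rangle>\<bar>\<close>, together with \<open>\<parallel>H\<parallel> = w(H) \<le> w(A)\<close>, bounds it from below.
  The theorem is this pair of bounds for the matrix \<open>A\<close> defining \<open>\<Delta>\<close>: its \<open>A\<^sup>2\<close> and
  \<open>A\<^sup>*A + AA\<^sup>*\<close> are the two matrices of the statement. Adjoints come from the Riesz theorem, and
  square roots from the iteration \<open>Y \<mapsto> (B + Y\<^sup>2)/2\<close>, which converges in norm to
  \<open>1 - (1 - B)\<^sup>1\<^sup>/\<^sup>2\<close> when \<open>\<parallel>B\<parallel> \<le> 1\<close>.
\<close>

section \<open>Complex inner products\<close>

lemma cinner_add_right: "cinner x (y + z) = cinner x y + cinner x z"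
  by (metis cinner_add_left cinner_commute complex_cnj_add)

lemma cinner_scaleC_right: "cinner x (c *\<^sub>C y) = cnj c * cinner x y"
  by (metis cinner_scaleC_left cinner_commute complex_cnj_mult)

lemma cinner_scaleR_left: "cinner (r *\<^sub>R x) y = r *\<^sub>R cinner x y"
  by (simp add: cinner_scaleC_left scaleR_conv_of_real flip: scaleC_of_real)

lemma cinner_scaleR_right: "cinner x (r *\<^sub>R y) = r *\<^sub>R cinner x y"
  by (simp add: cinner_scaleC_right scaleR_conv_of_real flip: scaleC_of_real)

lemma power2_norm_add:
  "(norm (x + y))\<^sup>2 = (norm x)\<^sup>2 + (norm y)\<^sup>2 + 2 * Re (cinner x y)"
proof -
  have "complex_of_real ((norm (x + y))\<^sup>2) =
      complex_of_real ((norm x)\<^sup>2) + complex_of_real ((norm y)\<^sup>2) + (cinner x y + cnj (cinner x y))"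
    unfolding cinner_self[symmetric]
    by (simp add: cinner_add_left cinner_add_right flip: cinner_commute)
  then have "Re (complex_of_real ((norm (x + y))\<^sup>2)) = Re (complex_of_real ((norm x)\<^sup>2)
      + complex_of_real ((norm y)\<^sup>2) + (cinner x y + cnj (cinner x y)))"
    by (rule arg_cong)
  then show ?thesis by simp
qed

text \<open>The triangle inequality is part of the norm structure here, so expanding both squares
  yields Cauchy-Schwarz for real parts.\<close>

lemma Re_cinner_le: "Re (cinner x y) \<le> norm x * norm y"
proof -
  have "(norm (x + y))\<^sup>2 \<le> (norm x + norm y)\<^sup>2"
    by (simp add: norm_triangle_ineq power_mono)
  then show ?thesis by (simp add: power2_norm_add power2_sum)
qed

lemma norm_scaleC: "norm (c *\<^sub>C x) = cmod c * norm x"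
proof -
  have "complex_of_real ((norm (c *\<^sub>C x))\<^sup>2) = (c * cnj c) * cinner x x"
    unfolding cinner_self[symmetric] by (simp add: cinner_scaleC_left cinner_scaleC_right)
  also have "\<dots> = complex_of_real ((cmod c * norm x)\<^sup>2)"
    by (simp only: cinner_self power_mult_distrib of_real_mult complex_norm_square)
  finally have "(norm (c *\<^sub>C x))\<^sup>2 = (cmod c * norm x)\<^sup>2"
    by (simp only: of_real_eq_iff)
  then show ?thesis by (rule power2_eq_imp_eq) auto
qed

text \<open>Multiplying by the phase \<open>c\<close> turns bounds on real parts into bounds on
  moduli. Both choices of the unimodular factor in the numerical radius bounds come from
  here.\<close>

lemma unimodular_rotation:
  obtains c where "cmod c = 1" "c * z = complex_of_real (cmod z)"
proof (cases "z = 0")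
  case True
  then show ?thesis using that[of 1] by simp
next
  case False
  have "cnj z * z = complex_of_real (cmod z) * complex_of_real (cmod z)"
    by (metis complex_norm_square mult.commute of_real_mult power2_eq_square)
  then have "cnj z / cmod z * z = complex_of_real (cmod z)"
    using False by simp
  then show ?thesis using that[of "cnj z / cmod z"] False by (simp add: norm_divide)
qed

lemma cmod_cinner_le: "cmod (cinner x y) \<le> norm x * norm y"
proof -
  obtain c where c: "cmod c = 1" "c * cinner x y = complex_of_real (cmod (cinner x y))"
    by (rule unimodular_rotation)
  have "cmod (cinner x y) = Re (cinner (c *\<^sub>C x) y)"
    by (simp add: cinner_scaleC_left c)
  also have "\<dots> \<le> norm (c *\<^sub>C x) * norm y" by (rule Re_cinner_le)
  finally show ?thesis by (simp add: norm_scaleC c)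
qed

lemma bounded_bilinear_cinner: "bounded_bilinear cinner"
  by (rule bounded_bilinear.intro)
    (auto simp: cinner_add_left cinner_add_right cinner_scaleR_left cinner_scaleR_right
      intro!: exI[of _ 1] cmod_cinner_le)

lemmas cinner_diff_left = bounded_bilinear.diff_left[OF bounded_bilinear_cinner]
  and cinner_diff_right = bounded_bilinear.diff_right[OF bounded_bilinear_cinner]
  and cinner_zero_left = bounded_bilinear.zero_left[OF bounded_bilinear_cinner]
  and cinner_zero_right = bounded_bilinear.zero_right[OF bounded_bilinear_cinner]
  and tendsto_cinner = bounded_bilinear.tendsto[OF bounded_bilinear_cinner]

lemma cinner_ext_right: "(\<And>z. cinner z x = cinner z y) \<Longrightarrow> x = y"
  using cinner_self[of "x - y"] by (simp add: cinner_diff_right)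

lemma scaleC_diff_right: "c *\<^sub>C (x - y) = c *\<^sub>C x - c *\<^sub>C y"
  by (metis add_diff_cancel diff_add_cancel scaleC_add_right)

lemma scaleC_scaleR: "c *\<^sub>C (r *\<^sub>R x) = r *\<^sub>R (c *\<^sub>C x)"
  by (simp add: scaleC_scaleC mult.commute flip: scaleC_of_real)

lemma bounded_linear_scaleC: "bounded_linear (\<lambda>x. c *\<^sub>C x)"
  by (rule bounded_linear_intro[where K = "cmod c"])
    (auto simp: scaleC_add_right scaleC_scaleR norm_scaleC)

lemma parallelogram_law:
  "(norm (x + y))\<^sup>2 + (norm (x - y))\<^sup>2 = 2 * (norm x)\<^sup>2 + 2 * (norm (y :: 'a :: complex_inner))\<^sup>2"
proof -
  have "(norm (x - y))\<^sup>2 = (norm x)\<^sup>2 + (norm y)\<^sup>2 - 2 * Re (cinner x y)"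
    using power2_norm_add[of x "- y"] bounded_bilinear.minus_right[OF bounded_bilinear_cinner, of x y]
    by simp
  then show ?thesis by (simp add: power2_norm_add)
qed

section \<open>The Riesz representation theorem and adjoints\<close>

text \<open>The representing vector is the minimiser of \<open>\<parallel>x\<parallel>\<^sup>2 - 2 Re (f x)\<close>.\<close>

lemma riesz_representation:
  fixes f :: "'a::chilbert_space \<Rightarrow> complex"
  assumes f: "bounded_linear f" and fC: "\<And>c x. f (c *\<^sub>C x) = c * f x"
  obtains y where "\<And>x. f x = cinner x y"
proof -
  interpret bounded_linear f by (rule f)
  define J where "J x = (norm x)\<^sup>2 - 2 * Re (f x)" for x
  obtain K where K: "\<And>x. norm (f x) \<le> norm x * K" using bounded by blast
  \<comment> \<open>Completing the square in \<open>norm x\<close>, where \<open>K\<close> bounds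
    \<open>f\<close>.\<close>
  have J_ge: "- K\<^sup>2 \<le> J x" for x
  proof -
    have "Re (f x) \<le> norm x * K" using complex_Re_le_cmod[of "f x"] K[of x] by linarith
    moreover have "0 \<le> (norm x - K)\<^sup>2" by simp
    ultimately show ?thesis by (simp add: J_def power2_diff)
  qed
  define m where "m = Inf (range J)"
  have bdd: "bdd_below (range J)" using J_ge by (auto intro!: bdd_belowI)
  have m_le: "m \<le> J x" for x unfolding m_def by (rule cInf_lower) (auto simp: bdd)
  have "\<exists>x. J x < m + e" if "e > 0" for e
    using cInf_lessD[of "range J" "m + e"] that unfolding m_def by auto
  then have "\<forall>n. \<exists>x. J x < m + 1 / Suc n" by simp
  then obtain u where u: "\<And>n. J (u n) < m + 1 / Suc n" by metis
  \<comment> \<open>The linear part of \<open>J\<close> cancels against the midpoint, where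
    \<open>J\<close> is at least \<open>m\<close>. The parallelogram law then forces near-minimisers
    to be close to each other.\<close>
  have sq: "(norm (x - y))\<^sup>2 \<le> 2 * (J x + J y - 2 * m)" for x y
  proof -
    have *: "norm ((1/2) *\<^sub>R (x + y)) ^ 2 = norm (x + y) ^ 2 / 4"
      by (simp add: power_divide)
    have "J x + J y - 2 * J ((1/2) *\<^sub>R (x + y)) = (norm (x - y))\<^sup>2 / 2"
      using parallelogram_law[of x y] unfolding J_def * by (simp add: scaleR add add_divide_distrib)
    then show ?thesis using m_le[of "(1/2) *\<^sub>R (x + y)"] by simp
  qed
  have "Cauchy u"
  proof (rule metric_CauchyI)
    fix e :: real assume "e > 0"
    then obtain N where N: "1 / real (Suc N) < e\<^sup>2 / 4"
      using reals_Archimedean[of "e\<^sup>2 / 4"] by (auto simp: inverse_eq_divide)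
    have "dist (u i) (u j) < e" if "i \<ge> N" "j \<ge> N" for i j
    proof -
      have "J (u n) < m + e\<^sup>2 / 4" if "n \<ge> N" for n
      proof -
        have "1 / real (Suc n) \<le> 1 / real (Suc N)" using that by (simp add: frac_le)
        then show ?thesis using u[of n] N by linarith
      qed
      from this[OF that(1)] this[OF that(2)] have "(norm (u i - u j))\<^sup>2 < e\<^sup>2"
        using sq[of "u i" "u j"] by simp
      then show ?thesis using \<open>e > 0\<close> by (simp add: dist_norm power_less_imp_less_base)
    qed
    then show "\<exists>M. \<forall>m\<ge>M. \<forall>n\<ge>M. dist (u m) (u n) < e" by blast
  qed
  then obtain y where y: "u \<longlonglongrightarrow> y" using Cauchy_convergent_iff convergent_def by blast
  have "(\<lambda>n. J (u n)) \<longlonglongrightarrow> J y" unfolding J_def by (intro tendsto_intros tendsto y)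
  moreover have "(\<lambda>n. m + 1 / Suc n) \<longlonglongrightarrow> m + 0"
    by (intro tendsto_intros lim_1_over_n[THEN LIMSEQ_Suc])
  ultimately have "J y \<le> m + 0"
    by (rule LIMSEQ_le) (use u less_imp_le in blast)
  then have min: "J y \<le> J x" for x using m_le[of x] by simp
  have Re_eq: "Re (f z) = Re (cinner z y)" for z
  proof -
    define d where "d = Re (cinner y z) - Re (f z)"
    \<comment> \<open>The variation of \<open>J\<close> at its minimiser \<open>y\<close> in the
      direction \<open>z\<close>.\<close>
    have quad: "0 \<le> 2 * t * d + t\<^sup>2 * (norm z)\<^sup>2" for t
      using min[of "y + t *\<^sub>R z"]
      by (simp add: J_def d_def power2_norm_add add scaleR cinner_scaleR_right algebra_simps
          power_mult_distrib)
    \<comment> \<open>This minimises the quadratic polynomial in \<open>t\<close>, up to the added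
      1, which also covers \<open>z = 0\<close>.\<close>
    define t where "t = - d / ((norm z)\<^sup>2 + 1)"
    have p: "(norm z)\<^sup>2 + 1 > 0" by (simp add: add_nonneg_pos)
    have "t\<^sup>2 * (norm z)\<^sup>2 \<le> t\<^sup>2 * ((norm z)\<^sup>2 + 1)" by (intro mult_left_mono) auto
    also have "\<dots> = - (t * d)" using p by (simp add: t_def power2_eq_square)
    finally have "0 \<le> t * d" using quad[of t] by linarith
    also have "t * d = - (d\<^sup>2 / ((norm z)\<^sup>2 + 1))" by (simp add: t_def power2_eq_square)
    finally have "d\<^sup>2 / ((norm z)\<^sup>2 + 1) \<le> 0" by simp
    then have "d = 0" using p by (simp add: divide_le_0_iff)
    then show ?thesis using cinner_commute[of z y] by (simp add: d_def)
  qed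
  \<comment> \<open>Applied to \<open>\<i> *\<^sub>C z\<close>, the identity of real parts yields
    that of imaginary parts.\<close>
  have "f z = cinner z y" for z
    using Re_eq[of z] Re_eq[of "\<i> *\<^sub>C z"] by (simp add: fC cinner_scaleC_left complex_eq_iff)
  then show thesis by (rule that)
qed

section \<open>Adjoints of complex-linear bounded operators\<close>

lemma bounded_operatorsD:
  "A \<in> bounded_operators \<Longrightarrow> blinfun_apply A (c *\<^sub>C x) = c *\<^sub>C blinfun_apply A x"
  by (simp add: bounded_operators_def)

text \<open>For each \<open>y\<close> the Riesz theorem represents the functional sending
  \<open>x\<close> to the inner product of \<open>A x\<close> with \<open>y\<close>. Uniqueness of
  the representing vector makes \<open>b\<close> linear.\<close>

lemma adjoint_exists:
  fixes A :: "'a::chilbert_space \<Rightarrow>\<^sub>L 'a"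
  assumes A: "A \<in> bounded_operators"
  obtains B where "\<And>x y. cinner (blinfun_apply A x) y = cinner x (blinfun_apply B y)"
proof -
  have "\<exists>z. \<forall>x. cinner (blinfun_apply A x) y = cinner x z" for y
  proof -
    have "bounded_linear (\<lambda>x. cinner (blinfun_apply A x) y)"
      by (rule bounded_linear_compose[OF bounded_bilinear.bounded_linear_left[OF bounded_bilinear_cinner]
            blinfun.bounded_linear_right])
    then show ?thesis
      by (rule riesz_representation) (auto simp: bounded_operatorsD[OF A] cinner_scaleC_left)
  qed
  then obtain b where b: "\<And>x y. cinner (blinfun_apply A x) y = cinner x (b y)" by metis
  have "bounded_linear b"
  proof (rule bounded_linear_intro[where K = "norm A"])
    show "b (x + y) = b x + b y" for x y
      by (rule cinner_ext_right) (simp add: cinner_add_right flip: b)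
    show "b (r *\<^sub>R x) = r *\<^sub>R b x" for r x
      by (rule cinner_ext_right) (simp add: cinner_scaleR_right flip: b)
    fix y
    \<comment> \<open>Testing the adjoint identity at \<open>x = b y\<close> bounds the square; one
      factor \<open>norm (b y)\<close> then cancels.\<close>
    have "(norm (b y))\<^sup>2 = cmod (cinner (b y) (b y))" by (simp add: cinner_self norm_power)
    also have "\<dots> = cmod (cinner (blinfun_apply A (b y)) y)" by (simp add: b)
    also have "\<dots> \<le> norm (blinfun_apply A (b y)) * norm y" by (rule cmod_cinner_le)
    also have "\<dots> \<le> norm A * norm (b y) * norm y" by (intro mult_right_mono norm_blinfun) auto
    finally show "norm (b y) \<le> norm y * norm A"
      by (cases "norm (b y) = 0") (auto simp: power2_eq_square mult.commute mult.left_commute)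
  qed
  then show thesis using that[of "Blinfun b"] b by (simp add: bounded_linear_Blinfun_apply)
qed

text \<open>Uniqueness turns the definite description behind \<open>adj\<close> into a rule:
  exhibiting an operator with the adjoint identity computes the adjoint.\<close>

lemma adj_eqI:
  assumes B: "\<And>x y. cinner (blinfun_apply A x) y = cinner x (blinfun_apply B y)"
  shows "adj A = B"
  unfolding adj_def
proof (rule the_equality)
  fix C assume C: "\<forall>x y. cinner (blinfun_apply A x) y = cinner x (blinfun_apply C y)"
  show "C = B"
    by (rule blinfun_eqI, rule cinner_ext_right) (metis B C)
qed (use B in blast)

lemma cinner_adj_right:
  assumes A: "A \<in> bounded_operators"
  shows "cinner x (blinfun_apply (adj A) y) = cinner (blinfun_apply A x) y"
  by (metis adjoint_exists[OF A] adj_eqI)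

lemma cinner_adj_left:
  assumes "A \<in> bounded_operators"
  shows "cinner (blinfun_apply (adj A) x) y = cinner x (blinfun_apply A y)"
  by (metis cinner_adj_right[OF assms] cinner_commute)

lemma adj_bounded_operators:
  assumes A: "A \<in> bounded_operators"
  shows "adj A \<in> bounded_operators"
proof -
  have "blinfun_apply (adj A) (c *\<^sub>C x) = c *\<^sub>C blinfun_apply (adj A) x" for c x
    by (rule cinner_ext_right) (simp add: cinner_adj_right[OF A] cinner_scaleC_right)
  then show ?thesis by (simp add: bounded_operators_def)
qed

lemma adj_adj: "A \<in> bounded_operators \<Longrightarrow> adj (adj A) = A"
  by (rule adj_eqI) (rule cinner_adj_left)

lemma bounded_operators_add:
  "A \<in> bounded_operators \<Longrightarrow> B \<in> bounded_operators \<Longrightarrow> A + B \<in> bounded_operators"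
  by (simp add: bounded_operators_def blinfun.add_left scaleC_add_right)

lemma bounded_operators_diff:
  "A \<in> bounded_operators \<Longrightarrow> B \<in> bounded_operators \<Longrightarrow> A - B \<in> bounded_operators"
  by (simp add: bounded_operators_def blinfun.diff_left scaleC_diff_right)

lemma bounded_operators_scaleR: "A \<in> bounded_operators \<Longrightarrow> r *\<^sub>R A \<in> bounded_operators"
  by (simp add: bounded_operators_def blinfun.scaleR_left scaleC_scaleR)

lemma bounded_operators_compose:
  "A \<in> bounded_operators \<Longrightarrow> B \<in> bounded_operators \<Longrightarrow> A o\<^sub>L B \<in> bounded_operators"
  by (simp add: bounded_operators_def)

lemma adj_add_scaleR:
  assumes "A \<in> bounded_operators" "B \<in> bounded_operators"
  shows "adj (A + r *\<^sub>R B) = adj A + r *\<^sub>R adj B"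
  by (rule adj_eqI) (simp add: blinfun.add_left blinfun.scaleR_left cinner_add_left cinner_add_right
      cinner_scaleR_left cinner_scaleR_right assms cinner_adj_right)

section \<open>Self-adjoint and positive operators\<close>

text \<open>Stated for functions rather than for \<open>blinfun\<close>, which carries no complex scalar multiples.\<close>

lemma selfadjoint_norm_le:
  fixes H :: "'a::complex_inner \<Rightarrow> 'a"
  assumes lin: "linear H" and sa: "\<And>x y. cinner (H x) y = cinner x (H y)"
    and bound: "\<And>x. cmod (cinner (H x) x) \<le> c * (norm x)\<^sup>2"
  shows "norm (H x) \<le> c * norm x"
proof (cases "H x = 0 \<or> x = 0")
  case True
  show ?thesis
  proof (cases "x = 0")
    case False
    have "0 \<le> c * (norm x)\<^sup>2" using bound[of x] by (rule order_trans[OF norm_ge_zero])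
    then show ?thesis using False True by (simp add: zero_le_mult_iff)
  qed (simp add: linear_0[OF lin])
next
  case False
  \<comment> \<open>Polarisation: self-adjointness makes the two mixed terms conjugate, so the
    difference of the quadratic forms at \<open>x + y\<close> and \<open>x - y\<close> is four times
    a real part.\<close>
  have polar: "4 * Re (cinner (H x) y) \<le> c * (2 * (norm x)\<^sup>2 + 2 * (norm y)\<^sup>2)" for y
  proof -
    have "cinner (H y) x = cnj (cinner (H x) y)" by (metis sa cinner_commute)
    then have "4 * Re (cinner (H x) y)
        = Re (cinner (H (x + y)) (x + y)) - Re (cinner (H (x - y)) (x - y))"
      by (simp add: linear_add[OF lin] linear_diff[OF lin] cinner_add_left cinner_add_right
          cinner_diff_left cinner_diff_right)
    also have "\<dots> \<le> c * (norm (x + y))\<^sup>2 + c * (norm (x - y))\<^sup>2"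
      using bound[of "x + y"] bound[of "x - y"] abs_Re_le_cmod[of "cinner (H (x + y)) (x + y)"]
        abs_Re_le_cmod[of "cinner (H (x - y)) (x - y)"] by linarith
    also have "\<dots> = c * (2 * (norm x)\<^sup>2 + 2 * (norm y)\<^sup>2)"
      by (simp only: parallelogram_law flip: distrib_left)
    finally show ?thesis .
  qed
  \<comment> \<open>Scaled so that \<open>y = r *\<^sub>R H x\<close> has the norm of
    \<open>x\<close>, which balances the two squares in \<open>polar\<close>.\<close>
  define r where "r = norm x / norm (H x)"
  have "Re (cinner (H x) (r *\<^sub>R H x)) = norm x * norm (H x)"
    using False by (simp add: cinner_scaleR_right cinner_self r_def power2_eq_square)
  moreover have "norm (r *\<^sub>R H x) = norm x" using False by (simp add: r_def)
  ultimately have "norm x * norm (H x) \<le> norm x * (c * norm x)"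
    using polar[of "r *\<^sub>R H x"] by (simp add: power2_eq_square algebra_simps)
  then show ?thesis using False by simp
qed

text \<open>The quadratic form is real at \<open>x + y\<close> and at
  \<open>x + \<i> *\<^sub>C y\<close>; the first gives the imaginary part of the identity, the
  second the real part.\<close>

lemma positive_operator_selfadjoint:
  assumes "positive_operator A"
  shows "cinner (blinfun_apply A x) y = cinner x (blinfun_apply A y)"
proof -
  have A: "A \<in> bounded_operators" and pos: "\<And>x. cinner (blinfun_apply A x) x \<in> \<real>\<^sub>\<ge>\<^sub>0"
    using assms by (auto simp: positive_operator_def)
  have re: "Im (cinner (blinfun_apply A x) x) = 0" for x
    using pos[of x] by (simp add: complex_nonneg_Reals_iff)
  have "cinner (blinfun_apply A x) y = cnj (cinner (blinfun_apply A y) x)"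
    using re[of "x + y"] re[of "x + \<i> *\<^sub>C y"] re[of x] re[of y]
    by (simp add: complex_eq_iff blinfun.add_right cinner_add_left cinner_add_right
        bounded_operatorsD[OF A] cinner_scaleC_left cinner_scaleC_right)
  then show ?thesis by (metis cinner_commute)
qed

lemma positive_operator_cinner:
  assumes "positive_operator A"
  obtains r where "0 \<le> r" "r \<le> norm A * (norm x)\<^sup>2" "cinner (blinfun_apply A x) x = complex_of_real r"
proof -
  have "cinner (blinfun_apply A x) x \<in> \<real>\<^sub>\<ge>\<^sub>0" using assms by (auto simp: positive_operator_def)
  then obtain r where r: "0 \<le> r" "cinner (blinfun_apply A x) x = complex_of_real r"
    by (auto simp: nonneg_Reals_def)
  have "r = cmod (cinner (blinfun_apply A x) x)" using r by simp
  also have "\<dots> \<le> norm (blinfun_apply A x) * norm x" by (rule cmod_cinner_le)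
  also have "\<dots> \<le> norm A * norm x * norm x" by (intro mult_right_mono norm_blinfun) auto
  finally show thesis using that r by (simp add: power2_eq_square mult.assoc)
qed

lemma positive_operator_adj_compose:
  assumes "A \<in> bounded_operators"
  shows "positive_operator (adj A o\<^sub>L A)"
  unfolding positive_operator_def
  by (simp add: assms bounded_operators_compose adj_bounded_operators cinner_adj_left cinner_self
      nonneg_Reals_of_real_iff del: of_real_power)

section \<open>Square roots of positive operators\<close>

primrec sqrt_iter :: "('a::real_normed_vector \<Rightarrow>\<^sub>L 'a) \<Rightarrow> nat \<Rightarrow> ('a \<Rightarrow>\<^sub>L 'a)" where
  "sqrt_iter B 0 = 0"
| "sqrt_iter B (Suc n) = (1/2) *\<^sub>R (B + op_sq (sqrt_iter B n))"

text \<open>The iteration for \<open>B = 1\<close> on the real line, which majorises the one for \<open>\<parallel>B\<parallel> \<le> 1\<close>.\<close>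

primrec sqrt_iter_real :: "nat \<Rightarrow> real" where
  "sqrt_iter_real 0 = 0"
| "sqrt_iter_real (Suc n) = (1 + (sqrt_iter_real n)\<^sup>2) / 2"

lemma sqrt_iter_real_bounds: "0 \<le> sqrt_iter_real n \<and> sqrt_iter_real n \<le> 1"
  by (induction n) (auto simp: power_le_one)

text \<open>Writing \<open>y\<close> for the current value, the increment is
  \<open>(y - 1)\<^sup>2 / 2\<close>.\<close>

lemma sqrt_iter_real_mono: "sqrt_iter_real n \<le> sqrt_iter_real (Suc n)"
  using zero_le_power2[of "sqrt_iter_real n - 1"] by (simp add: power2_diff)

lemma norm_sqrt_iter_le: "norm B \<le> 1 \<Longrightarrow> norm (sqrt_iter B n) \<le> sqrt_iter_real n"
proof (induction n)
  case (Suc n)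
  have "norm (op_sq (sqrt_iter B n)) \<le> sqrt_iter_real n * sqrt_iter_real n"
    by (rule order_trans[OF norm_blinfun_compose mult_mono])
      (use Suc sqrt_iter_real_bounds in auto)
  then have "norm (op_sq (sqrt_iter B n)) \<le> (sqrt_iter_real n)\<^sup>2"
    by (simp add: power2_eq_square)
  then show ?case
    using norm_triangle_ineq[of B "op_sq (sqrt_iter B n)"] Suc.prems by simp
qed simp

text \<open>Operator and scalar increments obey the same recursion, so submultiplicativity of the
  norm carries the majorisation through the induction.\<close>

lemma norm_sqrt_iter_diff_le:
  assumes "norm B \<le> 1"
  shows "norm (sqrt_iter B (Suc n) - sqrt_iter B n) \<le> sqrt_iter_real (Suc n) - sqrt_iter_real n"
proof (induction n)
  case 0
  then show ?case using assms by simp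
next
  case (Suc n)
  let ?Y = "sqrt_iter B" and ?y = sqrt_iter_real
  let ?D = "?Y (Suc n) - ?Y n" and ?d = "?y (Suc n) - ?y n"
  \<comment> \<open>The identity \<open>a\<^sup>2 - b\<^sup>2 = a (a - b) + (a - b) b\<close>, valid
    in noncommutative rings.\<close>
  have *: "?Y (Suc (Suc n)) - ?Y (Suc n) = (1/2) *\<^sub>R ((?Y (Suc n) o\<^sub>L ?D) + (?D o\<^sub>L ?Y n))"
    unfolding sqrt_iter.simps(2)[of B "Suc n"] sqrt_iter.simps(2)[of B n]
    by (rule blinfun_eqI) (simp add: blinfun.bilinear_simps algebra_simps)
  have "norm (?Y (Suc n) o\<^sub>L ?D) \<le> ?y (Suc n) * ?d"
    by (rule order_trans[OF norm_blinfun_compose mult_mono])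
      (use norm_sqrt_iter_le[OF assms] Suc sqrt_iter_real_bounds in
        \<open>auto simp del: sqrt_iter.simps sqrt_iter_real.simps\<close>)
  moreover have "norm (?D o\<^sub>L ?Y n) \<le> ?d * ?y n"
    by (rule order_trans[OF norm_blinfun_compose mult_mono])
      (use norm_sqrt_iter_le[OF assms] Suc sqrt_iter_real_bounds sqrt_iter_real_mono in
        \<open>auto simp del: sqrt_iter.simps sqrt_iter_real.simps\<close>)
  moreover have "?y (Suc (Suc n)) - ?y (Suc n) = (1/2) * (?y (Suc n) * ?d + ?d * ?y n)"
  proof -
    have "(1 + a\<^sup>2) / 2 - (1 + b\<^sup>2) / 2 = (1/2) * (a * (a - b) + (a - b) * b)" for a b :: real
      by (simp add: power2_eq_square field_simps)
    from this[of "?y (Suc n)" "?y n"] show ?thesis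
      by (simp only: flip: sqrt_iter_real.simps(2))
  qed
  ultimately show ?case
    unfolding * using norm_triangle_ineq[of "?Y (Suc n) o\<^sub>L ?D" "?D o\<^sub>L ?Y n"] by simp
qed

text \<open>The scalar increments telescope to a convergent series, which dominates the operator
  increments.\<close>

lemma convergent_sqrt_iter:
  fixes B :: "'a::banach \<Rightarrow>\<^sub>L 'a"
  assumes "norm B \<le> 1"
  shows "convergent (sqrt_iter B)"
proof -
  have "Bseq sqrt_iter_real"
    by (rule BseqI'[of _ 1]) (simp add: sqrt_iter_real_bounds)
  then have "convergent sqrt_iter_real"
    by (rule Bseq_mono_convergent)
      (use incseq_SucI[of sqrt_iter_real] sqrt_iter_real_mono in \<open>auto dest: incseqD\<close>)
  then have "summable (\<lambda>n. sqrt_iter_real (Suc n) - sqrt_iter_real n)"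
    by (auto simp: convergent_def simp del: sqrt_iter_real.simps intro: telescope_summable)
  then have "summable (\<lambda>n. sqrt_iter B (Suc n) - sqrt_iter B n)"
    by (rule summable_comparison_test') (rule norm_sqrt_iter_diff_le[OF assms])
  then have "convergent (\<lambda>n. \<Sum>i<n. sqrt_iter B (Suc i) - sqrt_iter B i)"
    by (simp add: summable_iff_convergent)
  then show ?thesis by (simp only: sum_lessThan_telescope sqrt_iter.simps(1) diff_zero)
qed

section \<open>Properties shared by all iterates\<close>

lemma sqrt_iter_bounded_operators:
  "B \<in> bounded_operators \<Longrightarrow> sqrt_iter B n \<in> bounded_operators"
proof (induction n)
  case 0
  have "c *\<^sub>C (0::'a) = 0" for c by (metis scaleC_scaleR scaleR_zero_left)
  then show ?case by (simp add: bounded_operators_def)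
qed (simp add: bounded_operators_add bounded_operators_scaleR bounded_operators_compose)

lemma sqrt_iter_selfadjoint:
  assumes "\<And>x y. cinner (blinfun_apply B x) y = cinner x (blinfun_apply B y)"
  shows "cinner (blinfun_apply (sqrt_iter B n) x) y = cinner x (blinfun_apply (sqrt_iter B n) y)"
  by (induction n arbitrary: x y)
    (simp_all add: assms blinfun.bilinear_simps cinner_add_left cinner_add_right
      cinner_scaleR_left cinner_scaleR_right cinner_zero_left cinner_zero_right)

lemma sqrt_iter_commute:
  assumes "C o\<^sub>L B = B o\<^sub>L C"
  shows "C o\<^sub>L sqrt_iter B n = sqrt_iter B n o\<^sub>L C"
proof (induction n)
  case (Suc n)
  have "blinfun_apply C (blinfun_apply B x) = blinfun_apply B (blinfun_apply C x)" 
    "blinfun_apply C (blinfun_apply (sqrt_iter B n) x) = blinfun_apply (sqrt_iter B n) (blinfun_apply C x)"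
    for x
    using arg_cong[OF assms, of "\<lambda>A. blinfun_apply A x"]
      arg_cong[OF Suc.IH, of "\<lambda>A. blinfun_apply A x"] by simp_all
  then show ?case by (auto intro!: blinfun_eqI simp: blinfun.bilinear_simps)
qed simp

text \<open>After scaling, \<open>B = 1 - A / k\<close> is a contraction, and the limit
  \<open>Y\<close> of the iteration satisfies \<open>(1 - Y)\<^sup>2 = 1 - B = A / k\<close>. The
  commutation clause later reduces uniqueness of the root to commuting roots.\<close>

lemma positive_sqrt_exists:
  fixes A :: "'a::chilbert_space \<Rightarrow>\<^sub>L 'a"
  assumes pos: "positive_operator A"
  obtains S where "positive_operator S" "op_sq S = A"
    "\<And>C. C o\<^sub>L A = A o\<^sub>L C \<Longrightarrow> C o\<^sub>L S = S o\<^sub>L C"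
proof -
  \<comment> \<open>The added 1 keeps \<open>k\<close> positive when \<open>A = 0\<close>.\<close>
  define k where "k = norm A + 1"
  have k: "k > 0" "norm A \<le> k" by (auto simp: k_def add_nonneg_pos)
  define B where "B = id_blinfun - (1/k) *\<^sub>R A"
  have A: "A \<in> bounded_operators" using pos by (simp add: positive_operator_def)
  have I: "id_blinfun \<in> bounded_operators" by (simp add: bounded_operators_def)
  have B: "B \<in> bounded_operators"
    unfolding B_def by (intro bounded_operators_diff bounded_operators_scaleR A I)
  have B_sa: "cinner (blinfun_apply B x) y = cinner x (blinfun_apply B y)" for x y
    by (simp add: B_def blinfun.bilinear_simps cinner_diff_left cinner_diff_right cinner_scaleR_left
        cinner_scaleR_right positive_operator_selfadjoint[OF pos])
  \<comment> \<open>The form of \<open>A / k\<close> lies between 0 and the squared norm, hence so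
    does that of \<open>B\<close>; self-adjointness upgrades this to a norm bound.\<close>
  have "cmod (cinner (blinfun_apply B x) x) \<le> 1 * (norm x)\<^sup>2" for x
  proof -
    obtain r where r: "0 \<le> r" "r \<le> norm A * (norm x)\<^sup>2" "cinner (blinfun_apply A x) x = complex_of_real r"
      by (rule positive_operator_cinner[OF pos])
    have "norm A * (norm x)\<^sup>2 \<le> k * (norm x)\<^sup>2" using k by (intro mult_right_mono) auto
    then have rk: "0 \<le> r / k" "r / k \<le> (norm x)\<^sup>2" using r k by (auto simp: field_simps)
    have "cinner (blinfun_apply B x) x = complex_of_real ((norm x)\<^sup>2 - r / k)"
      unfolding of_real_diff cinner_self[symmetric]
      by (simp add: B_def blinfun.bilinear_simps cinner_diff_left cinner_scaleR_left r scaleR_conv_of_real)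
    then have "cmod (cinner (blinfun_apply B x) x) = \<bar>(norm x)\<^sup>2 - r / k\<bar>"
      by (simp only: norm_of_real)
    then show ?thesis using rk by simp
  qed
  then have "norm (blinfun_apply B x) \<le> 1 * norm x" for x
    by (rule selfadjoint_norm_le[OF bounded_linear.linear[OF blinfun.bounded_linear_right] B_sa])
  then have nB: "norm B \<le> 1" by (intro norm_blinfun_bound) auto
  obtain Y where Y: "sqrt_iter B \<longlonglongrightarrow> Y"
    using convergent_sqrt_iter[OF nB] by (auto simp: convergent_def)
  have Y_app: "(\<lambda>n. blinfun_apply (sqrt_iter B n) x) \<longlonglongrightarrow> blinfun_apply Y x" for x
    by (intro tendsto_intros Y)
  note comp = bounded_bilinear.tendsto[OF bounded_bilinear_blinfun_compose]
  have Y_eq: "Y = (1/2) *\<^sub>R (B + op_sq Y)"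
    by (rule LIMSEQ_unique[OF LIMSEQ_Suc[OF Y]], unfold sqrt_iter.simps(2))
      (intro tendsto_intros comp Y)
  have "norm (sqrt_iter B n) \<le> 1" for n
    using norm_sqrt_iter_le[OF nB, of n] sqrt_iter_real_bounds[of n] by linarith
  then have nY: "norm Y \<le> 1" by (intro LIMSEQ_le_const2[OF tendsto_norm[OF Y]]) auto
  have Y_sa: "cinner (blinfun_apply Y x) y = cinner x (blinfun_apply Y y)" for x y
  proof (rule LIMSEQ_unique)
    show "(\<lambda>n. cinner (blinfun_apply (sqrt_iter B n) x) y) \<longlonglongrightarrow> cinner (blinfun_apply Y x) y"
      by (intro tendsto_cinner tendsto_const Y_app)
    show "(\<lambda>n. cinner (blinfun_apply (sqrt_iter B n) x) y) \<longlonglongrightarrow> cinner x (blinfun_apply Y y)"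
      unfolding sqrt_iter_selfadjoint[OF B_sa] by (intro tendsto_cinner tendsto_const Y_app)
  qed
  have Y_bo: "Y \<in> bounded_operators"
    unfolding bounded_operators_def
  proof safe
    fix c x
    have "(\<lambda>n. blinfun_apply (sqrt_iter B n) (c *\<^sub>C x)) \<longlonglongrightarrow> c *\<^sub>C blinfun_apply Y x"
      unfolding bounded_operatorsD[OF sqrt_iter_bounded_operators[OF B]]
      by (rule bounded_linear.tendsto[OF bounded_linear_scaleC Y_app])
    then show "blinfun_apply Y (c *\<^sub>C x) = c *\<^sub>C blinfun_apply Y x"
      by (rule LIMSEQ_unique[OF Y_app])
  qed
  define S where "S = sqrt k *\<^sub>R (id_blinfun - Y)"
  show thesis
  proof (rule that)
    have "cinner (blinfun_apply S x) x \<in> \<real>\<^sub>\<ge>\<^sub>0" for x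
    proof -
      have "cinner (blinfun_apply Y x) x = cnj (cinner (blinfun_apply Y x) x)"
        by (metis Y_sa cinner_commute)
      then have im: "Im (cinner (blinfun_apply Y x) x) = 0" by (simp add: complex_eq_iff)
      have "Re (cinner (blinfun_apply Y x) x) \<le> norm (blinfun_apply Y x) * norm x"
        by (rule Re_cinner_le)
      also have "\<dots> \<le> norm Y * norm x * norm x" by (intro mult_right_mono norm_blinfun) auto
      also have "\<dots> \<le> 1 * norm x * norm x" by (intro mult_right_mono nY) auto
      finally have re: "Re (cinner (blinfun_apply Y x) x) \<le> (norm x)\<^sup>2" by (simp add: power2_eq_square)
      have "cinner (blinfun_apply S x) x = sqrt k *\<^sub>R (complex_of_real ((norm x)\<^sup>2) - cinner (blinfun_apply Y x) x)"
        unfolding cinner_self[symmetric]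
        by (simp add: S_def blinfun.bilinear_simps cinner_diff_left cinner_scaleR_left)
      then show ?thesis using im re k by (simp add: complex_nonneg_Reals_iff del: of_real_power)
    qed
    then show "positive_operator S"
      unfolding positive_operator_def
      by (auto simp: S_def intro: bounded_operators_scaleR bounded_operators_diff I Y_bo)
    \<comment> \<open>The fixed-point equation is rearranged to express \<open>op_sq Y\<close>, so
      that squaring \<open>S\<close> leaves only \<open>B\<close>.\<close>
    have "2 *\<^sub>R Y = 2 *\<^sub>R ((1/2) *\<^sub>R (B + op_sq Y))" by (rule arg_cong[OF Y_eq])
    then have "B + op_sq Y = 2 *\<^sub>R Y" by simp
    then have "op_sq Y = 2 *\<^sub>R Y - B" by (simp add: eq_diff_eq add.commute)
    then have Y2: "blinfun_apply Y (blinfun_apply Y x) = 2 *\<^sub>R blinfun_apply Y x - blinfun_apply B x" for x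
      by (metis blinfun_apply_blinfun_compose blinfun.diff_left blinfun.scaleR_left)
    show "op_sq S = A"
    proof (rule blinfun_eqI)
      fix x
      have "blinfun_apply (op_sq S) x = k *\<^sub>R (x - blinfun_apply B x)"
        using k by (simp add: S_def blinfun.bilinear_simps Y2 scaleR_2 flip: scaleR_diff_right)
      also have "\<dots> = blinfun_apply A x" using k by (simp add: B_def blinfun.bilinear_simps)
      finally show "blinfun_apply (op_sq S) x = blinfun_apply A x" .
    qed
    fix C assume C: "C o\<^sub>L A = A o\<^sub>L C"
    have CA: "blinfun_apply C (blinfun_apply A x) = blinfun_apply A (blinfun_apply C x)" for x
      using arg_cong[OF C, of "\<lambda>A. blinfun_apply A x"] by simp
    have "C o\<^sub>L B = B o\<^sub>L C"
      by (rule blinfun_eqI) (simp add: B_def blinfun.bilinear_simps CA)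
    then have "C o\<^sub>L sqrt_iter B n = sqrt_iter B n o\<^sub>L C" for n by (rule sqrt_iter_commute)
    moreover have "(\<lambda>n. C o\<^sub>L sqrt_iter B n) \<longlonglongrightarrow> (C o\<^sub>L Y)"
      "(\<lambda>n. sqrt_iter B n o\<^sub>L C) \<longlonglongrightarrow> (Y o\<^sub>L C)"
      by (intro comp tendsto_const Y)+
    ultimately have CY: "C o\<^sub>L Y = Y o\<^sub>L C" by (simp add: LIMSEQ_unique)
    have CY': "blinfun_apply C (blinfun_apply Y x) = blinfun_apply Y (blinfun_apply C x)" for x
      using arg_cong[OF CY, of "\<lambda>A. blinfun_apply A x"] by simp
    show "C o\<^sub>L S = S o\<^sub>L C"
      by (rule blinfun_eqI) (simp add: S_def blinfun.bilinear_simps CY')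
  qed
qed

text \<open>With a positive root \<open>D\<close> of \<open>S\<close>, the form of \<open>S\<close>
  at \<open>y\<close> is the squared norm of \<open>D y\<close>.\<close>

lemma positive_operator_kernel:
  fixes S :: "'a::chilbert_space \<Rightarrow>\<^sub>L 'a"
  assumes S: "positive_operator S" and 0: "cinner (blinfun_apply S y) y = 0"
  shows "blinfun_apply S y = 0"
proof -
  obtain D where D: "positive_operator D" "op_sq D = S" by (rule positive_sqrt_exists[OF S])
  have S_eq: "blinfun_apply S x = blinfun_apply D (blinfun_apply D x)" for x
    by (simp flip: D(2))
  have "cinner (blinfun_apply D y) (blinfun_apply D y) = 0"
    using 0 by (simp add: S_eq positive_operator_selfadjoint[OF D(1)])
  then have "blinfun_apply D y = 0" by (simp add: cinner_self)
  then show ?thesis by (simp add: S_eq blinfun.zero_right)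
qed

text \<open>
  With \<open>y = (S - C)x\<close>, commutation turns \<open>S\<^sup>2 = C\<^sup>2\<close> into \<open>\<langle>Sy,y\<rangle> + \<langle>Cy,y\<rangle> = 0\<close>, so that
  \<open>Sy = Cy = 0\<close>.
\<close>

lemma positive_sqrt_unique_commuting:
  fixes S C :: "'a::chilbert_space \<Rightarrow>\<^sub>L 'a"
  assumes S: "positive_operator S" and C: "positive_operator C"
    and eq: "op_sq S = op_sq C" and comm: "C o\<^sub>L S = S o\<^sub>L C"
  shows "S = C"
proof (rule blinfun_eqI)
  fix x
  define y where "y = blinfun_apply S x - blinfun_apply C x"
  have "blinfun_apply C (blinfun_apply S x) = blinfun_apply S (blinfun_apply C x)"
    "blinfun_apply S (blinfun_apply S x) = blinfun_apply C (blinfun_apply C x)"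
    using arg_cong[OF comm, of "\<lambda>A. blinfun_apply A x"] arg_cong[OF eq, of "\<lambda>A. blinfun_apply A x"]
    by simp_all
  then have "blinfun_apply S y + blinfun_apply C y = 0"
    by (simp add: y_def blinfun.bilinear_simps)
  then have "cinner (blinfun_apply S y) y + cinner (blinfun_apply C y) y = 0"
    by (simp add: cinner_zero_left flip: cinner_add_left)
  moreover obtain r where "0 \<le> r" "cinner (blinfun_apply S y) y = complex_of_real r"
    by (rule positive_operator_cinner[OF S])
  moreover obtain t where "0 \<le> t" "cinner (blinfun_apply C y) y = complex_of_real t"
    by (rule positive_operator_cinner[OF C])
  ultimately have "cinner (blinfun_apply S y) y = 0" "cinner (blinfun_apply C y) y = 0"
    by (simp_all flip: of_real_add)
  then have 0: "blinfun_apply S y = 0" "blinfun_apply C y = 0"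
    by (auto intro: positive_operator_kernel S C)
  \<comment> \<open>Self-adjointness moves \<open>S - C\<close> onto the second argument, leaving
    only the vanishing \<open>S y\<close> and \<open>C y\<close>.\<close>
  have "cinner y y = cinner x (blinfun_apply S y) - cinner x (blinfun_apply C y)"
    by (subst y_def) (simp add: cinner_diff_left positive_operator_selfadjoint[OF S] positive_operator_selfadjoint[OF C])
  then have "y = 0" by (simp add: 0 cinner_self)
  then show "blinfun_apply S x = blinfun_apply C x" by (simp add: y_def)
qed

text \<open>Any positive root \<open>C\<close> commutes with its square \<open>A\<close>, hence with
  the constructed root \<open>S\<close>, so the uniqueness of commuting roots applies.\<close>

lemma op_sq_op_sqrt:
  assumes "positive_operator A"
  shows "op_sq (op_sqrt A) = A"
proof -
  obtain S where S: "positive_operator S" "op_sq S = A"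
    and comm: "\<And>C. C o\<^sub>L A = A o\<^sub>L C \<Longrightarrow> C o\<^sub>L S = S o\<^sub>L C"
    by (rule positive_sqrt_exists[OF assms]) blast
  have "op_sqrt A = S"
    unfolding op_sqrt_def
  proof (rule the_equality)
    fix C assume C: "positive_operator C \<and> op_sq C = A"
    then have "C o\<^sub>L A = A o\<^sub>L C" by (auto intro!: blinfun_eqI)
    then have "C o\<^sub>L S = S o\<^sub>L C" by (rule comm)
    then show "C = S" using positive_sqrt_unique_commuting[of S C] S C by simp
  qed (use S in blast)
  then show ?thesis using S by simp
qed

text \<open>Absolute values occur in the final statement only squared; this removes them
  all.\<close>

lemma op_sq_op_abs: "A \<in> bounded_operators \<Longrightarrow> op_sq (op_abs A) = adj A o\<^sub>L A"
  unfolding op_abs_def by (intro op_sq_op_sqrt positive_operator_adj_compose)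

section \<open>Numerical radius bounds\<close>

lemma cmod_cinner_blinfun_le: "cmod (cinner (blinfun_apply A z) z) \<le> norm A * (norm z)\<^sup>2"
proof -
  have "cmod (cinner (blinfun_apply A z) z) \<le> norm (blinfun_apply A z) * norm z"
    by (rule cmod_cinner_le)
  also have "\<dots> \<le> norm A * norm z * norm z" by (intro mult_right_mono norm_blinfun) auto
  finally show ?thesis by (simp add: power2_eq_square mult.assoc)
qed

lemma numerical_radius_upper:
  assumes "norm z = 1"
  shows "cmod (cinner (blinfun_apply A z) z) \<le> numerical_radius A"
  unfolding numerical_radius_def
proof (rule cSUP_upper)
  have "cmod (cinner (blinfun_apply A z) z) \<le> norm A" if "norm z = 1" for z
    using cmod_cinner_blinfun_le[of A z] that by simp
  then show "bdd_above ((\<lambda>z. cmod (cinner (blinfun_apply A z) z)) ` {z. norm z = 1})"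
    by (intro bdd_aboveI2[of _ _ "norm A"]) auto
qed (simp add: assms)

lemma crawford_number_lower:
  assumes "norm z = 1"
  shows "crawford_number A \<le> cmod (cinner (blinfun_apply A z) z)"
  unfolding crawford_number_def
  by (rule cINF_lower) (auto simp: assms intro!: bdd_belowI2[of _ 0])

lemma cmod_cinner_bound_of_unit:
  fixes f :: "'a::complex_inner \<Rightarrow> 'a"
  assumes "linear f" and unit: "\<And>z. norm z = 1 \<Longrightarrow> cmod (cinner (f z) z) \<le> c"
  shows "cmod (cinner (f x) x) \<le> c * (norm x)\<^sup>2"
proof (cases "x = 0")
  case True
  then show ?thesis by (simp add: cinner_zero_right)
next
  case False
  define z where "z = (1 / norm x) *\<^sub>R x"
  have x: "x = norm x *\<^sub>R z" and z: "norm z = 1" using False by (auto simp: z_def)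
  have "cmod (cinner (f x) x) = cmod (cinner (f (norm x *\<^sub>R z)) (norm x *\<^sub>R z))"
    by (simp flip: x)
  also have "\<dots> = cmod (cinner (f z) z) * (norm x)\<^sup>2"
    by (simp add: linear_scale[OF assms(1)] cinner_scaleR_left cinner_scaleR_right power2_eq_square)
  also have "\<dots> \<le> c * (norm x)\<^sup>2" by (intro mult_right_mono unit z) auto
  finally show ?thesis .
qed

text \<open>Homogeneity extends the bound from unit vectors to the whole space, where
  self-adjointness turns it into a norm bound. A unit vector also shows
  \<open>0 \<le> c\<close>.\<close>

lemma norm_le_of_unit_cinner:
  fixes A :: "'a::complex_inner \<Rightarrow>\<^sub>L 'a"
  assumes nontrivial: "\<exists>x::'a. x \<noteq> 0"
    and sa: "\<And>x y. cinner (blinfun_apply A x) y = cinner x (blinfun_apply A y)"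
    and unit: "\<And>z. norm z = 1 \<Longrightarrow> cmod (cinner (blinfun_apply A z) z) \<le> c"
  shows "norm A \<le> c"
proof (rule norm_blinfun_bound)
  obtain x :: 'a where "x \<noteq> 0" using nontrivial by blast
  then have "norm ((1 / norm x) *\<^sub>R x) = 1" by simp
  from unit[OF this] show "0 \<le> c" by (rule order_trans[OF norm_ge_zero])
  have lin: "linear (blinfun_apply A)"
    by (rule bounded_linear.linear[OF blinfun.bounded_linear_right])
  show "norm (blinfun_apply A x) \<le> c * norm x" for x
    by (rule selfadjoint_norm_le[OF lin sa cmod_cinner_bound_of_unit[OF lin unit]])
qed

text \<open>The vector is twice the real part of \<open>cA\<close> at \<open>x\<close>, which clears
  the fractions. In the cross term both phases multiply to \<open>c\<^sup>2\<close>, and moving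
  \<open>B\<close> across gives \<open>op_sq A\<close>.\<close>

lemma power2_norm_rotated_real_part:
  assumes adj: "\<And>x y. cinner (blinfun_apply A x) y = cinner x (blinfun_apply B y)"
    and c: "cmod c = 1"
  shows "(norm (c *\<^sub>C blinfun_apply A x + cnj c *\<^sub>C blinfun_apply B x))\<^sup>2 =
    Re (cinner (blinfun_apply ((B o\<^sub>L A) + (A o\<^sub>L B)) x) x)
      + 2 * Re (c\<^sup>2 * cinner (blinfun_apply (op_sq A) x) x)"
proof -
  have sq: "(norm v)\<^sup>2 = Re (cinner v v)" for v :: 'a by (simp add: cinner_self)
  have adj': "cinner (blinfun_apply B x) y = cinner x (blinfun_apply A y)" for x y
    by (metis adj cinner_commute)
  have "(norm (c *\<^sub>C blinfun_apply A x))\<^sup>2 = Re (cinner (blinfun_apply B (blinfun_apply A x)) x)"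
    "(norm (cnj c *\<^sub>C blinfun_apply B x))\<^sup>2 = Re (cinner (blinfun_apply A (blinfun_apply B x)) x)"
    by (simp_all add: norm_scaleC c sq adj' adj[of "blinfun_apply B x"])
  moreover have "cinner (c *\<^sub>C blinfun_apply A x) (cnj c *\<^sub>C blinfun_apply B x)
      = c\<^sup>2 * cinner (blinfun_apply A (blinfun_apply A x)) x"
    by (simp add: cinner_scaleC_left cinner_scaleC_right adj power2_eq_square mult.assoc)
  ultimately show ?thesis
    by (simp add: power2_norm_add blinfun.add_left cinner_add_left)
qed

text \<open>The adjoint enters as an operator \<open>B\<close> with the defining identity, so for a
  matrix it can simply be written down.\<close>

theorem numerical_radius_power2_bounds:
  fixes A B :: "'a::complex_inner \<Rightarrow>\<^sub>L 'a"
  assumes nontrivial: "\<exists>x::'a. x \<noteq> 0"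
    and adj: "\<And>x y. cinner (blinfun_apply A x) y = cinner x (blinfun_apply B y)"
  shows "norm ((B o\<^sub>L A) + (A o\<^sub>L B)) / 4 + crawford_number (op_sq A) / 2 \<le> (numerical_radius A)\<^sup>2"
    and "(numerical_radius A)\<^sup>2 \<le> norm ((B o\<^sub>L A) + (A o\<^sub>L B)) / 4 + numerical_radius (op_sq A) / 2"
proof -
  define G where "G = (B o\<^sub>L A) + (A o\<^sub>L B)"
  define H where "H c x = c *\<^sub>C blinfun_apply A x + cnj c *\<^sub>C blinfun_apply B x" for c x
  let ?w = "numerical_radius A"
  have adj': "cinner (blinfun_apply B x) y = cinner x (blinfun_apply A y)" for x y
    by (metis adj cinner_commute)
  have norm_H: "(norm (H c x))\<^sup>2 = Re (cinner (blinfun_apply G x) x)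
      + 2 * Re (c\<^sup>2 * cinner (blinfun_apply (op_sq A) x) x)" if "cmod c = 1" for c x
    unfolding H_def G_def by (rule power2_norm_rotated_real_part[OF adj that])
  have cinner_H: "cinner (H c x) x = complex_of_real (2 * Re (c * cinner (blinfun_apply A x) x))" for c x
  proof -
    have "cinner (H c x) x = c * cinner (blinfun_apply A x) x + cnj (c * cinner (blinfun_apply A x) x)"
      by (simp add: H_def cinner_add_left cinner_scaleC_left adj' flip: cinner_commute)
    then show ?thesis by (simp only: complex_add_cnj)
  qed
  obtain x0 :: 'a where "x0 \<noteq> 0" using nontrivial by blast
  define e where "e = (1 / norm x0) *\<^sub>R x0"
  have e: "norm e = 1" using \<open>x0 \<noteq> 0\<close> by (simp add: e_def)
  have w0: "0 \<le> ?w" using numerical_radius_upper[OF e, of A] by (rule order_trans[OF norm_ge_zero])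

  \<comment> \<open>Upper bound: \<open>c\<close> rotates the form of \<open>A\<close> at
    \<open>z\<close> to its modulus, so Cauchy-Schwarz compares it with
    \<open>H c z\<close>.\<close>
  have "4 * (cmod (cinner (blinfun_apply A z) z))\<^sup>2 \<le> norm G + 2 * numerical_radius (op_sq A)"
    if z: "norm z = 1" for z
  proof -
    obtain c where c: "cmod c = 1"
      "c * cinner (blinfun_apply A z) z = complex_of_real (cmod (cinner (blinfun_apply A z) z))"
      by (rule unimodular_rotation)
    have "2 * cmod (cinner (blinfun_apply A z) z) = cmod (cinner (H c z) z)"
      by (simp add: cinner_H c)
    also have "\<dots> \<le> norm (H c z)" using cmod_cinner_le[of "H c z" z] z by simp
    finally have "(2 * cmod (cinner (blinfun_apply A z) z))\<^sup>2 \<le> (norm (H c z))\<^sup>2"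
      by (rule power_mono) simp
    moreover have "Re (cinner (blinfun_apply G z) z) \<le> norm G"
      using complex_Re_le_cmod[of "cinner (blinfun_apply G z) z"] cmod_cinner_blinfun_le[of G z] z by simp
    moreover have "Re (c\<^sup>2 * cinner (blinfun_apply (op_sq A) z) z) \<le> numerical_radius (op_sq A)"
      using complex_Re_le_cmod[of "c\<^sup>2 * cinner (blinfun_apply (op_sq A) z) z"]
        numerical_radius_upper[OF z, of "op_sq A"] c by (simp add: norm_mult norm_power)
    ultimately show ?thesis using norm_H[OF c(1), of z] by (simp add: power_mult_distrib)
  qed
  then have "cmod (cinner (blinfun_apply A z) z) \<le> sqrt (norm G / 4 + numerical_radius (op_sq A) / 2)"
    if "norm z = 1" for z
    using that by (intro real_le_rsqrt) fastforce
  then have le: "?w \<le> sqrt (norm G / 4 + numerical_radius (op_sq A) / 2)"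
    unfolding numerical_radius_def[of A] by (intro cSUP_least) (use e in auto)
  have "0 \<le> numerical_radius (op_sq A)"
    using numerical_radius_upper[OF e, of "op_sq A"] by (rule order_trans[OF norm_ge_zero])
  then have "(sqrt (norm G / 4 + numerical_radius (op_sq A) / 2))\<^sup>2
      = norm G / 4 + numerical_radius (op_sq A) / 2" by simp
  then show "?w\<^sup>2 \<le> norm ((B o\<^sub>L A) + (A o\<^sub>L B)) / 4 + numerical_radius (op_sq A) / 2"
    using power_mono[OF le w0, of 2] by (simp add: G_def)

  have G_sa: "cinner (blinfun_apply G x) y = cinner x (blinfun_apply G y)" for x y
    by (simp add: G_def blinfun.add_left cinner_add_left cinner_add_right adj adj')
  have A_lin: "linear (blinfun_apply A)"
    by (rule bounded_linear.linear[OF blinfun.bounded_linear_right])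
  have H_lin: "linear (H c)" for c
    by (rule linearI) (simp_all add: H_def blinfun.bilinear_simps scaleC_add_right scaleC_scaleR
        scaleR_add_right algebra_simps)
  have H_sa: "cinner (H c x) y = cinner x (H c y)" for c x y
    by (simp add: H_def cinner_add_left cinner_add_right cinner_scaleC_left cinner_scaleC_right adj adj')
  \<comment> \<open>Lower bound: \<open>H c\<close> is self-adjoint, and its form is at most twice
    that of \<open>A\<close> in modulus.\<close>
  have H_le: "norm (H c x) \<le> 2 * ?w * norm x" if c: "cmod c = 1" for c x
  proof (rule selfadjoint_norm_le[OF H_lin H_sa])
    fix x
    have "cmod (cinner (H c x) x) \<le> 2 * cmod (c * cinner (blinfun_apply A x) x)"
      using abs_Re_le_cmod[of "c * cinner (blinfun_apply A x) x"] by (simp only: cinner_H norm_of_real)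
    also have "\<dots> \<le> 2 * (?w * (norm x)\<^sup>2)"
      using cmod_cinner_bound_of_unit[OF A_lin numerical_radius_upper] c by (simp add: norm_mult)
    finally show "cmod (cinner (H c x) x) \<le> 2 * ?w * (norm x)\<^sup>2" by simp
  qed
  have "norm G \<le> 4 * ?w\<^sup>2 - 2 * crawford_number (op_sq A)"
  proof (rule norm_le_of_unit_cinner[OF nontrivial G_sa])
    fix z :: 'a assume z: "norm z = 1"
    let ?q = "cinner (blinfun_apply (op_sq A) z) z"
    obtain d where d: "cmod d = 1" "d * ?q = complex_of_real (cmod ?q)" by (rule unimodular_rotation)
    \<comment> \<open>A square root of the phase, since the form of \<open>op_sq A\<close> carries
      the factor \<open>c\<^sup>2\<close>.\<close>
    define c where "c = csqrt d"
    have c: "cmod c = 1" "c\<^sup>2 * ?q = complex_of_real (cmod ?q)" using d by (simp_all add: c_def)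
    have "(norm (H c z))\<^sup>2 \<le> (2 * ?w)\<^sup>2" using H_le[OF c(1), of z] z by (intro power_mono) auto
    then have "Re (cinner (blinfun_apply G z) z) + 2 * cmod ?q \<le> 4 * ?w\<^sup>2"
      unfolding norm_H[OF c(1)] c(2) by (simp add: power_mult_distrib)
    \<comment> \<open>The form of \<open>G\<close> is nonnegative, so its modulus equals its real
      part.\<close>
    moreover have "cinner (blinfun_apply G z) z = complex_of_real ((norm (blinfun_apply A z))\<^sup>2 + (norm (blinfun_apply B z))\<^sup>2)"
      unfolding of_real_add cinner_self[symmetric]
      by (simp add: G_def blinfun.add_left cinner_add_left adj adj')
    then have "cmod (cinner (blinfun_apply G z) z) = Re (cinner (blinfun_apply G z) z)"
      by (simp only: norm_of_real Re_complex_of_real) simp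
    moreover have "crawford_number (op_sq A) \<le> cmod ?q" by (rule crawford_number_lower[OF z])
    ultimately show "cmod (cinner (blinfun_apply G z) z) \<le> 4 * ?w\<^sup>2 - 2 * crawford_number (op_sq A)"
      by linarith
  qed
  then show "norm ((B o\<^sub>L A) + (A o\<^sub>L B)) / 4 + crawford_number (op_sq A) / 2 \<le> ?w\<^sup>2"
    by (simp add: G_def)
qed

text \<open>A nonzero vector guarantees unit vectors, over which the supremum and infimum are
  taken.\<close>

theorem theorem2p17:
  fixes \<rho> \<nu> \<alpha> \<beta> :: real
    and X Q R T S M N P :: "'a::chilbert_space \<Rightarrow>\<^sub>L 'a"
  assumes nontrivial: "\<exists>x::'a. x \<noteq> 0"
    and rho: "0 < \<rho>" "\<rho> \<le> 2"
    and nu: "0 \<le> \<nu>" "\<nu> \<le> 1"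
    and alpha: "\<alpha> = sqrt (8 / \<rho> - 4)"
    and beta: "\<beta> = 2 / \<rho> - 2"
    and X: "X \<in> bounded_operators"
    and Q: "Q = (\<alpha>\<^sup>2 * (1 - 2 * \<nu>)) *\<^sub>R op_sq (op_abs (adj X))"
    and R: "R = (\<alpha> * \<beta>) *\<^sub>R (op_sq X + (1 - 2 * \<nu>) *\<^sub>R op_sq (op_abs (adj X)))"
    and T: "T = (\<alpha> * \<beta> * (1 - 2 * \<nu>)) *\<^sub>R
                  (op_sq (op_abs (adj X)) + (1 - 2 * \<nu>) *\<^sub>R op_sq (adj X))"
    and S: "S = (\<alpha>\<^sup>2 * (1 - 2 * \<nu>)) *\<^sub>R op_sq (op_abs X)
                  + \<beta>\<^sup>2 *\<^sub>R op_sq (X + (1 - 2 * \<nu>) *\<^sub>R adj X)"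
    and M: "M = (\<alpha>\<^sup>2 * (1 + (1 - 2 * \<nu>)\<^sup>2)) *\<^sub>R op_sq (op_abs (adj X))"
    and N: "N = (2 * \<alpha> * \<beta> * (1 - 2 * \<nu>)) *\<^sub>R op_sq X
                  + (\<alpha> * \<beta> * (1 + (1 - 2 * \<nu>)\<^sup>2)) *\<^sub>R op_sq (op_abs (adj X))"
    and P: "P = (\<alpha>\<^sup>2 * (1 + (1 - 2 * \<nu>)\<^sup>2)) *\<^sub>R op_sq (op_abs X)
                  + \<beta>\<^sup>2 *\<^sub>R (op_sq (op_abs (X + (1 - 2 * \<nu>) *\<^sub>R adj X))
                            + op_sq (op_abs (adj X + (1 - 2 * \<nu>) *\<^sub>R X)))"
  shows "1 / 4 * norm (op_matrix M N (adj N) P) + 1 / 2 * crawford_number (op_matrix Q R T S)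
           \<le> (Delta \<rho> \<nu> X)\<^sup>2
       \<and> (Delta \<rho> \<nu> X)\<^sup>2
           \<le> 1 / 4 * norm (op_matrix M N (adj N) P) + 1 / 2 * numerical_radius (op_matrix Q R T S)"
proof -
  define t where "t = 1 - 2 * \<nu>"
  let ?Xs = "adj X"
  let ?A = "op_matrix 0 (\<alpha> *\<^sub>R X) ((\<alpha> * t) *\<^sub>R ?Xs) (\<beta> *\<^sub>R (X + t *\<^sub>R ?Xs))"
  \<comment> \<open>The adjoint of \<open>?A\<close>: transposed, with adjoint entries.\<close>
  let ?B = "op_matrix 0 ((\<alpha> * t) *\<^sub>R X) (\<alpha> *\<^sub>R ?Xs) (\<beta> *\<^sub>R (?Xs + t *\<^sub>R X))"
  have Xs: "?Xs \<in> bounded_operators" by (rule adj_bounded_operators[OF X])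
  have abs_X: "op_sq (op_abs X) = ?Xs o\<^sub>L X" by (rule op_sq_op_abs[OF X])
  have abs_Xs: "op_sq (op_abs ?Xs) = X o\<^sub>L ?Xs" by (simp add: op_sq_op_abs[OF Xs] adj_adj[OF X])
  have abs_XXs: "op_sq (op_abs (X + t *\<^sub>R ?Xs)) = (?Xs + t *\<^sub>R X) o\<^sub>L (X + t *\<^sub>R ?Xs)"
    by (simp add: op_sq_op_abs bounded_operators_add bounded_operators_scaleR X Xs adj_add_scaleR adj_adj)
  have abs_XsX: "op_sq (op_abs (?Xs + t *\<^sub>R X)) = (X + t *\<^sub>R ?Xs) o\<^sub>L (?Xs + t *\<^sub>R X)"
    by (simp add: op_sq_op_abs bounded_operators_add bounded_operators_scaleR X Xs adj_add_scaleR adj_adj)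
  \<comment> \<open>\<open>X o\<^sub>L adj X\<close> is its own adjoint, so only the square of
    \<open>X\<close> changes.\<close>
  have adj_N: "adj N = (2 * \<alpha> * \<beta> * t) *\<^sub>R op_sq ?Xs + (\<alpha> * \<beta> * (1 + t\<^sup>2)) *\<^sub>R (X o\<^sub>L ?Xs)"
    unfolding N abs_Xs t_def[symmetric]
    by (rule adj_eqI) (simp add: blinfun.bilinear_simps cinner_add_left cinner_add_right
        cinner_scaleR_left cinner_scaleR_right cinner_adj_left[OF X]
        cinner_adj_right[OF X, symmetric])
  have sq: "op_sq ?A = op_matrix Q R T S"
    unfolding Q R T S abs_X abs_Xs t_def[symmetric]
    by (rule blinfun_eqI)
      (simp add: blinfun_apply_op_matrix blinfun.bilinear_simps algebra_simps power2_eq_square)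
  \<comment> \<open>Both products in \<open>sum\<close> contribute one copy of this term to
    \<open>N\<close> and to \<open>adj N\<close>; splitting it lets the summands match.\<close>
  have double: "(2 * \<alpha> * \<beta> * t) *\<^sub>R Z = (\<alpha> * \<beta> * t) *\<^sub>R Z + (\<alpha> * \<beta> * t) *\<^sub>R Z" for Z :: "'a \<Rightarrow>\<^sub>L 'a"
    by (simp flip: scaleR_add_left)
  have sum: "(?B o\<^sub>L ?A) + (?A o\<^sub>L ?B) = op_matrix M N (adj N) P"
    unfolding adj_N unfolding M N P abs_X abs_Xs t_def[symmetric] abs_XXs abs_XsX double
    by (rule blinfun_eqI)
      (simp add: blinfun_apply_op_matrix blinfun.bilinear_simps algebra_simps power2_eq_square)
  have nontrivial': "\<exists>z::'a \<times> 'a. z \<noteq> 0" using nontrivial by (auto simp: zero_prod_def)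
  have adj: "cinner (blinfun_apply ?A x) y = cinner x (blinfun_apply ?B y)" for x y
    by (simp add: blinfun_apply_op_matrix cinner_prod_def blinfun.bilinear_simps cinner_add_left
        cinner_add_right cinner_scaleR_left cinner_scaleR_right cinner_adj_left[OF X]
        cinner_adj_right[OF X] algebra_simps)
  have Delta: "Delta \<rho> \<nu> X = numerical_radius ?A"
    by (simp add: Delta_def Let_def alpha beta t_def)
  show ?thesis
    using numerical_radius_power2_bounds[OF nontrivial' adj] unfolding Delta sq sum by simp
qed

end
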